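(* Every LJ-polynomial is a regular Laurent polynomial.
   Context: Notation: $\mathbb{T}=\{z\in\mathbb{C}:|z|=1\}$. A Laurent polynomial is a function $b(z)=\sum_{j=-m}^{k}b_jz^j$ with $m,k\in\mathbb{N}$ (so $m,k\ge 1$), $b_j\in\mathbb{C}$, and $b_{-m}b_k\neq0$. LJ-polynomial (Laurent polynomial with the Jordan property): a Laurent polynomial $b$ such that the closed curve $b(\mathbb{T})$ is a Jordan curve (no self-intersections, i.e. $t\mapsto b(t)$ is injective on $\mathbb{T}$) and $b'(t)\ne0$ for all $t\in\mathbb{T}$. Regular Laurent polynomial: let $\Omega(b)$ be the set of $w\in\mathbb{C}\setminus b(\mathbb{T})$ such that the winding number of the closed curve $t\mapsto b(t)$, $t\in\mathbb{T}$, around $w$ is zero. For $w\in\mathbb{C}$ let $Z(w)$ be the multiset of the $m+k$ roots (with multiplicity) of the polynomial $P(z,w)=z^m(b(z)-w)$ in $z$, and let $Z_{in}(w)$ and $Z_{ext}(w)$ be the parts of $Z(w)$ in $\{|z|<1\}$ and $\{|z|>1\}$, respectively. The Laurent polynomial $b$ is regular if at least one of the following holds: there is $r(b)\in(0,1)$ such that $Z_{in}(w)\subset\{|z|\le r(b)\}$ for all $w\in\Omega(b)$; or there is $R(b)>1$ such that $Z_{ext}(w)\subset\{|z|\ge R(b)\}$ for all $w\in\Omega(b)$. *)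

theory Defs
  imports
    "HOL-Complex_Analysis.Complex_Analysis"
    "HOL-Computational_Algebra.Computational_Algebra"
begin

(* A Laurent polynomial is given by the orders m, k and the coefficients b_j, -m <= j <= k;
   values of the coefficient function outside {-m..k} are never used. *)
definition laurent_polynomial :: "nat \<Rightarrow> nat \<Rightarrow> (int \<Rightarrow> complex) \<Rightarrow> bool" where
  "laurent_polynomial m k b \<longleftrightarrow> m \<ge> 1 \<and> k \<ge> 1 \<and> b (- int m) \<noteq> 0 \<and> b (int k) \<noteq> 0"

definition laurent_eval :: "nat \<Rightarrow> nat \<Rightarrow> (int \<Rightarrow> complex) \<Rightarrow> complex \<Rightarrow> complex" where
  "laurent_eval m k b z = (\<Sum>j = - int m..int k. b j * z powi j)"

definition LJ_polynomial :: "nat \<Rightarrow> nat \<Rightarrow> (int \<Rightarrow> complex) \<Rightarrow> bool" where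
  "LJ_polynomial m k b \<longleftrightarrow>
     laurent_polynomial m k b \<and>
     inj_on (laurent_eval m k b) (sphere 0 1) \<and>
     (\<forall>t \<in> sphere 0 1. deriv (laurent_eval m k b) t \<noteq> 0)"

definition Omega :: "nat \<Rightarrow> nat \<Rightarrow> (int \<Rightarrow> complex) \<Rightarrow> complex set" where
  "Omega m k b =
     {w. w \<notin> laurent_eval m k b ` sphere 0 1 \<and>
         winding_number (laurent_eval m k b \<circ> circlepath 0 1) w = 0}"

(* The polynomial P(z, w) = z^m (b(z) - w) in z; see poly_shifted_poly. *)
definition shifted_poly :: "nat \<Rightarrow> nat \<Rightarrow> (int \<Rightarrow> complex) \<Rightarrow> complex \<Rightarrow> complex poly" where
  "shifted_poly m k b w = (\<Sum>i\<le>m + k. monom (b (int i - int m)) i) - monom w m"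

lemma poly_shifted_poly:
  assumes "z \<noteq> 0"
  shows "poly (shifted_poly m k b w) z = z ^ m * (laurent_eval m k b z - w)"
proof -
  have "(\<Sum>i\<le>m + k. b (int i - int m) * z ^ i) =
        (\<Sum>j = - int m..int k. z ^ m * (b j * z powi j))"
  proof (rule sum.reindex_bij_witness[of _ "\<lambda>j. nat (j + int m)" "\<lambda>i. int i - int m"])
    fix i assume "i \<in> {..m + k}"
    show "z ^ m * (b (int i - int m) * z powi (int i - int m)) = b (int i - int m) * z ^ i"
      using assms by (simp add: power_int_diff)
  qed auto
  then show ?thesis
    by (simp add: shifted_poly_def laurent_eval_def poly_sum poly_monom sum_distrib_left
        algebra_simps)
qed

definition Z_roots :: "nat \<Rightarrow> nat \<Rightarrow> (int \<Rightarrow> complex) \<Rightarrow> complex \<Rightarrow> complex multiset" where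
  "Z_roots m k b w = proots (shifted_poly m k b w)"

lemma size_Z_roots:
  assumes "laurent_polynomial m k b"
  shows "size (Z_roots m k b w) = m + k"
proof -
  let ?p = "shifted_poly m k b w"
  have c: "coeff ?p i = (if i \<le> m + k then b (int i - int m) else 0) - (if i = m then w else 0)"
    for i
    by (auto simp: shifted_poly_def coeff_sum)
  have "degree ?p = m + k"
  proof (rule antisym)
    show "degree ?p \<le> m + k"
      by (rule degree_le) (auto simp: c)
    show "m + k \<le> degree ?p"
      using assms by (intro le_degree) (auto simp: c laurent_polynomial_def)
  qed
  then show ?thesis
    by (simp add: Z_roots_def size_proots_complex)
qed

definition Z_in :: "nat \<Rightarrow> nat \<Rightarrow> (int \<Rightarrow> complex) \<Rightarrow> complex \<Rightarrow> complex multiset" where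
  "Z_in m k b w = filter_mset (\<lambda>z. norm z < 1) (Z_roots m k b w)"

definition Z_ext :: "nat \<Rightarrow> nat \<Rightarrow> (int \<Rightarrow> complex) \<Rightarrow> complex \<Rightarrow> complex multiset" where
  "Z_ext m k b w = filter_mset (\<lambda>z. norm z > 1) (Z_roots m k b w)"

definition regular_laurent_polynomial :: "nat \<Rightarrow> nat \<Rightarrow> (int \<Rightarrow> complex) \<Rightarrow> bool" where
  "regular_laurent_polynomial m k b \<longleftrightarrow>
     laurent_polynomial m k b \<and>
     ((\<exists>r::real. 0 < r \<and> r < 1 \<and>
         (\<forall>w \<in> Omega m k b. set_mset (Z_in m k b w) \<subseteq> {z. norm z \<le> r})) \<or>
      (\<exists>R::real. R > 1 \<and>
         (\<forall>w \<in> Omega m k b. set_mset (Z_ext m k b w) \<subseteq> {z. norm z \<ge> R})))"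

end

theory Submission
  imports Defs
begin

text \<open>
  Write \<open>J = b(T)\<close> for the Jordan curve traced by \<open>b\<close> on the unit circle \<open>T\<close>. Since \<open>b\<close> is injective
  on the compact set \<open>T\<close> and, because \<open>b'\<close> has no zero on \<open>T\<close>, locally injective at each of its
  points, \<open>b\<close> is injective on a whole annulus \<open>A\<close> around \<open>T\<close>
  (\<open>inj_on_neighbourhood_of_compact\<close>). So \<open>b\<close> maps both halves of \<open>A\<close>, the one inside and the one
  outside the unit disc, into the complement of \<open>J\<close>. Each half is connected, hence the winding
  number of \<open>J\<close> is constant on the image of each half.

  These two constants cannot both be zero. Indeed \<open>b(A)\<close> is an open set that contains \<open>J\<close>, and
  by the Jordan curve theorem every point of \<open>J\<close> is a limit of points around which \<open>J\<close> winds
  once, in one direction or the other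
  (\<open>simple_closed_path_nonzero_winding_number_nearby\<close>); such points of \<open>b(A)\<close> lie in the image of
  one of the halves. So one half \<open>H\<close> of \<open>A\<close> is sent entirely outside \<open>Omega m k b\<close>, that is, for
  \<open>w\<close> in \<open>Omega m k b\<close> the equation \<open>b z = w\<close> has no solution \<open>z\<close> in \<open>H\<close>. According to whether \<open>H\<close>
  is the inner or the outer half, this is the first or the second alternative in the definition of
  regularity.
\<close>

section \<open>Injectivity near a compact set\<close>

text \<open>
  If injectivity failed on every neighbourhood, there would be pairs of distinct points with equal
  values and at distance tending to zero from \<open>K\<close>. By compactness both members of the pairs
  accumulate at points of \<open>K\<close> with equal values, thus at one and the same point, where this
  contradicts local injectivity.
\<close>

lemma inj_on_neighbourhood_of_compact:
  fixes f :: "'a::metric_space \<Rightarrow> 'b::t2_space"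
  assumes "compact K" and inj: "inj_on f K"
    and cont: "\<And>x. x \<in> K \<Longrightarrow> isCont f x"
    and loc: "\<And>x. x \<in> K \<Longrightarrow> \<exists>r>0. inj_on f (ball x r)"
  shows "\<exists>e>0. inj_on f (\<Union>x\<in>K. ball x e)"
proof (rule ccontr)
  assume contra: "\<not> ?thesis"
  have "\<exists>z w u v. u \<in> K \<and> v \<in> K \<and> dist u z < inverse (real (Suc n)) \<and>
          dist v w < inverse (real (Suc n)) \<and> f z = f w \<and> z \<noteq> w" for n
  proof -
    have "\<not> inj_on f (\<Union>x\<in>K. ball x (inverse (real (Suc n))))"
      using contra by (metis inverse_positive_iff_positive of_nat_0_less_iff zero_less_Suc)
    then show ?thesis
      unfolding inj_on_def by (simp add: Bex_def) blast
  qed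
  then obtain z w u v where K: "\<And>n. u n \<in> K" "\<And>n. v n \<in> K"
    and du: "\<And>n. dist (u n) (z n) < inverse (real (Suc n))"
    and dv: "\<And>n. dist (v n) (w n) < inverse (real (Suc n))"
    and eq: "\<And>n. f (z n) = f (w n)" and ne: "\<And>n. z n \<noteq> w n"
    by metis
  have "compact (K \<times> K)"
    using \<open>compact K\<close> by (intro compact_Times)
  then obtain l \<sigma> where l: "l \<in> K \<times> K" and \<sigma>: "strict_mono (\<sigma> :: nat \<Rightarrow> nat)"
    and lim: "((\<lambda>n. (u n, v n)) \<circ> \<sigma>) \<longlonglongrightarrow> l"
    using K unfolding compact_def by (metis (no_types, lifting) mem_Sigma_iff)
  have approach: "(y \<circ> \<sigma>) \<longlonglongrightarrow> p"
    if "(x \<circ> \<sigma>) \<longlonglongrightarrow> p" and d: "\<And>n. dist (x n) (y n) < inverse (real (Suc n))"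
    for x y :: "nat \<Rightarrow> 'a" and p
  proof -
    have "((\<lambda>n. inverse (real (Suc n))) \<circ> \<sigma>) \<longlonglongrightarrow> 0"
      using LIMSEQ_inverse_real_of_nat \<sigma> by (rule LIMSEQ_subseq_LIMSEQ)
    then have "(\<lambda>n. dist (x (\<sigma> n)) (y (\<sigma> n))) \<longlonglongrightarrow> 0"
      by (rule tendsto_sandwich[rotated 2, OF tendsto_const])
         (auto intro!: always_eventually less_imp_le d simp del: of_nat_Suc)
    moreover have "(\<lambda>n. dist (x (\<sigma> n)) p) \<longlonglongrightarrow> 0"
      using that(1) unfolding o_def by (rule tendsto_dist_iff[THEN iffD1])
    ultimately have sum: "(\<lambda>n. dist (x (\<sigma> n)) (y (\<sigma> n)) + dist (x (\<sigma> n)) p) \<longlonglongrightarrow> 0"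
      by (rule tendsto_add_zero)
    have "dist (y (\<sigma> n)) p \<le> dist (dist (x (\<sigma> n)) (y (\<sigma> n)) + dist (x (\<sigma> n)) p) 0" for n
      using dist_triangle3[of "y (\<sigma> n)" p "x (\<sigma> n)"] by (simp add: dist_real_def)
    then show ?thesis
      unfolding o_def by (intro metric_tendsto_imp_tendsto[OF sum] always_eventually allI)
  qed
  have "(u \<circ> \<sigma>) \<longlonglongrightarrow> fst l" "(v \<circ> \<sigma>) \<longlonglongrightarrow> snd l"
    using tendsto_fst[OF lim] tendsto_snd[OF lim] by (simp_all add: o_def)
  then have z: "(z \<circ> \<sigma>) \<longlonglongrightarrow> fst l" and w: "(w \<circ> \<sigma>) \<longlonglongrightarrow> snd l"
    using approach du dv by blast+
  have "(\<lambda>n. f (z (\<sigma> n))) \<longlonglongrightarrow> f (fst l)" "(\<lambda>n. f (w (\<sigma> n))) \<longlonglongrightarrow> f (snd l)"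
    using isCont_tendsto_compose[OF cont z] isCont_tendsto_compose[OF cont w] l
    by (auto simp: o_def)
  then have "f (fst l) = f (snd l)"
    using LIMSEQ_unique by (simp add: eq)
  then have "fst l = snd l"
    using inj_onD[OF inj] l by (simp add: mem_Times_iff)
  obtain r where "r > 0" and r: "inj_on f (ball (fst l) r)"
    using loc[of "fst l"] l by (auto simp: mem_Times_iff)
  then have "eventually (\<lambda>n. z (\<sigma> n) \<in> ball (fst l) r \<and> w (\<sigma> n) \<in> ball (fst l) r) sequentially"
    using tendstoD[OF z \<open>r > 0\<close>] tendstoD[OF w \<open>r > 0\<close>]
    by (simp add: \<open>fst l = snd l\<close> eventually_conj_iff dist_commute)
  then obtain n where "z (\<sigma> n) \<in> ball (fst l) r" "w (\<sigma> n) \<in> ball (fst l) r"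
    using eventually_happens' sequentially_bot by blast
  then show False
    using inj_onD[OF r eq] ne by blast
qed

section \<open>Winding numbers near a Jordan curve\<close>

text \<open>
  The curve is the frontier of its inside, and at the points of the inside the
  winding number is \<open>1\<close> or \<open>-1\<close>.
\<close>

lemma simple_closed_path_nonzero_winding_number_nearby:
  fixes c :: "real \<Rightarrow> complex"
  assumes "simple_path c" "pathfinish c = pathstart c"
    and "open U" "p \<in> U" "p \<in> path_image c"
  obtains q where "q \<in> U" "q \<notin> path_image c" "winding_number c q \<noteq> 0"
proof -
  have "p \<in> closure (inside (path_image c))"
    using Jordan_inside_outside[OF assms(1,2)] \<open>p \<in> path_image c\<close>
    by (auto simp: frontier_def)
  then obtain q where q: "q \<in> U" "q \<in> inside (path_image c)"
    using assms(3,4) by (meson disjoint_iff open_Int_closure_eq_empty)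
  have "winding_number c q \<noteq> 0"
    by (rule simple_closed_path_winding_number_inside[OF \<open>simple_path c\<close>]) (use q in fastforce)+
  with q that show ?thesis
    using inside_no_overlap by blast
qed

section \<open>Laurent polynomials\<close>

lemma laurent_eval_holomorphic: "laurent_eval m k b holomorphic_on - {0}"
  unfolding laurent_eval_def by (intro holomorphic_intros) auto

lemma Z_roots_nonzero_imp_laurent_eval:
  assumes "laurent_polynomial m k b" "z \<in># Z_roots m k b w" "z \<noteq> 0"
  shows "laurent_eval m k b z = w"
proof -
  have "shifted_poly m k b w \<noteq> 0"
    using size_Z_roots[OF assms(1), of w] assms(1)
    by (auto simp: Z_roots_def laurent_polynomial_def)
  then have "poly (shifted_poly m k b w) z = 0"
    using assms(2) by (simp add: Z_roots_def)
  then show ?thesis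
    using assms(3) by (simp add: poly_shifted_poly)
qed

text \<open>
  The nonvanishing derivative on the circle gives the local injectivity from which
  injectivity spreads to an annulus. The bound \<open>e < 1\<close> keeps the pole at \<open>0\<close> out of it.
\<close>

lemma LJ_polynomial_inj_on_annulus:
  assumes "LJ_polynomial m k b"
  obtains e where "0 < e" "e < 1"
    "inj_on (laurent_eval m k b) {z. 1 - e < norm z \<and> norm z < 1 + e}"
proof -
  let ?f = "laurent_eval m k b"
  have "\<exists>e>0. inj_on ?f (\<Union>x\<in>sphere 0 1. ball x e)"
  proof (rule inj_on_neighbourhood_of_compact)
    show "inj_on ?f (sphere 0 1)"
      using assms by (simp add: LJ_polynomial_def)
    fix x :: complex assume x: "x \<in> sphere 0 1"
    then have x0: "x \<in> - {0}"
      by auto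
    show "isCont ?f x"
      using holomorphic_on_imp_continuous_on[OF laurent_eval_holomorphic] x0
      by (simp add: continuous_on_eq_continuous_at open_Compl)
    have "deriv ?f x \<noteq> 0"
      using assms x by (simp add: LJ_polynomial_def)
    then show "\<exists>r>0. inj_on ?f (ball x r)"
      using has_complex_derivative_locally_injective[OF laurent_eval_holomorphic x0]
      by (metis finite.emptyI finite.insertI finite_imp_closed open_Compl)
  qed auto
  then obtain d where d: "d > 0" "inj_on ?f (\<Union>x\<in>sphere 0 1. ball x d)"
    by auto
  define e where "e = min d (1/2)"
  have e: "0 < e" "e < 1" "e \<le> d"
    using \<open>d > 0\<close> by (auto simp: e_def)
  have "{z::complex. 1 - e < norm z \<and> norm z < 1 + e} \<subseteq> (\<Union>x\<in>sphere 0 1. ball x d)"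
  proof
    fix z :: complex assume "z \<in> {z. 1 - e < norm z \<and> norm z < 1 + e}"
    then have z: "\<bar>1 - norm z\<bar> < e" "norm z > 0"
      using e by auto
    \<comment> \<open>\<open>sgn z\<close> is the radial projection of \<open>z\<close> to the circle.\<close>
    have "sgn z - z = of_real (1 - norm z) * sgn z"
      using z by (simp add: sgn_eq field_simps)
    then have "dist (sgn z) z = \<bar>1 - norm z\<bar>"
      using z by (simp add: dist_norm norm_mult norm_sgn del: of_real_diff)
    with z e have "z \<in> ball (sgn z) d"
      by simp
    moreover have "sgn z \<in> sphere 0 1"
      using z by (simp add: norm_sgn)
    ultimately show "z \<in> (\<Union>x\<in>sphere 0 1. ball x d)"
      by blast
  qed
  with e d that show thesis
    using inj_on_subset by blast
qed

text \<open>
  This is the geometric content of regularity: one of the two sides of the circle is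
  mapped, near the circle, to the inside of the curve, which is disjoint from \<open>Omega m k b\<close>.
\<close>

lemma LJ_polynomial_one_sided_annulus_avoids_Omega:
  assumes LJ: "LJ_polynomial m k b"
  obtains e where "0 < e" "e < 1"
    "(\<forall>z. 1 - e < norm z \<and> norm z < 1 \<longrightarrow> laurent_eval m k b z \<notin> Omega m k b) \<or>
     (\<forall>z. 1 < norm z \<and> norm z < 1 + e \<longrightarrow> laurent_eval m k b z \<notin> Omega m k b)"
proof -
  obtain e where e: "0 < e" "e < 1"
    and inj: "inj_on (laurent_eval m k b) {z. 1 - e < norm z \<and> norm z < 1 + e}"
    using LJ_polynomial_inj_on_annulus[OF LJ] .
  define f where "f = laurent_eval m k b"
  define c where "c = f \<circ> circlepath 0 1"
  define A where "A = {z::complex. 1 - e < norm z \<and> norm z < 1 + e}"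
  define A1 where "A1 = {z::complex. 1 - e < norm z \<and> norm z < 1}"
  define A2 where "A2 = {z::complex. 1 < norm z \<and> norm z < 1 + e}"
  have A: "A = A1 \<union> sphere 0 1 \<union> A2"
    using e by (auto simp: A_def A1_def A2_def)
  have "connected A" "connected A1" "connected A2"
    using connected_annulus(1)[of _ "0::complex"] by (simp_all add: A_def A1_def A2_def)
  have "open A"
    unfolding A_def by (intro open_Collect_conj open_Collect_less continuous_intros)
  have "A \<subseteq> - {0}"
    using e by (auto simp: A_def)
  then have holf: "f holomorphic_on A"
    unfolding f_def using laurent_eval_holomorphic holomorphic_on_subset by blast
  then have contf: "continuous_on A f"
    by (rule holomorphic_on_imp_continuous_on)
  have inj: "inj_on f A"
    using inj by (simp add: f_def A_def)

  have im: "path_image c = f ` sphere 0 1"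
    by (simp add: c_def path_image_compose)
  have c: "simple_path c"
    unfolding c_def
  proof (rule simple_path_continuous_image)
    show "simple_path (circlepath (0::complex) 1)"
      by (simp add: simple_path_circlepath)
    show "continuous_on (path_image (circlepath 0 1)) f"
      using contf by (rule continuous_on_subset) (auto simp: A)
    show "inj_on f (path_image (circlepath 0 1))"
      using inj by (rule inj_on_subset) (auto simp: A)
  qed
  then have "path c"
    by (rule simple_path_imp_path)
  have loop: "pathfinish c = pathstart c"
    by (simp add: c_def pathfinish_compose pathstart_compose)

  have const: "winding_number c constant_on f ` H" if "H = A1 \<or> H = A2" for H
  proof (rule winding_number_constant[OF \<open>path c\<close> loop])
    have H: "H \<subseteq> A" "H \<inter> sphere 0 1 = {}"
      using that by (auto simp: A A1_def A2_def)
    show "connected (f ` H)"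
      using that \<open>connected A1\<close> \<open>connected A2\<close> H contf
      by (metis connected_continuous_image continuous_on_subset)
    have "sphere 0 1 \<subseteq> A"
      by (auto simp: A)
    then show "f ` H \<inter> path_image c = {}"
      using inj_on_image_Int[OF inj H(1)] H(2) by (metis im image_empty)
  qed

  have "open (f ` A)"
  proof (rule open_mapping_thm[OF holf \<open>open A\<close> \<open>connected A\<close> \<open>open A\<close>])
    show "\<not> f constant_on A"
    proof
      assume "f constant_on A"
      moreover have "1 \<in> A" "-1 \<in> A"
        using e by (auto simp: A_def)
      ultimately have "f 1 = f (-1)"
        by (auto simp: constant_on_def)
      then show False
        using inj_onD[OF inj _ \<open>1 \<in> A\<close> \<open>-1 \<in> A\<close>] by simp
    qed
  qed auto
  moreover have "f 1 \<in> f ` A" "f 1 \<in> path_image c"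
    by (auto simp: im A)
  ultimately obtain q where q: "q \<in> f ` A" "q \<notin> path_image c" "winding_number c q \<noteq> 0"
    using simple_closed_path_nonzero_winding_number_nearby[OF c loop] by blast
  then have "q \<in> f ` A1 \<or> q \<in> f ` A2"
    by (auto simp: A im)
  then obtain H where H: "H = A1 \<or> H = A2" and "q \<in> f ` H"
    by blast
  then have "winding_number c (f z) \<noteq> 0" if "z \<in> H" for z
    using const[OF H] q(3) that unfolding constant_on_def by (metis imageI)
  then have "\<forall>z\<in>H. f z \<notin> Omega m k b"
    by (simp add: Omega_def c_def f_def)
  then show thesis
    using that[OF e] H by (auto simp: A1_def A2_def f_def)
qed

theorem theorem1p7:
  fixes m k :: nat and b :: "int \<Rightarrow> complex"
  assumes "LJ_polynomial m k b"
  shows "regular_laurent_polynomial m k b"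
proof -
  have lp: "laurent_polynomial m k b"
    using assms by (simp add: LJ_polynomial_def)
  obtain e where e: "0 < e" "e < 1"
    and side: "(\<forall>z. 1 - e < norm z \<and> norm z < 1 \<longrightarrow> laurent_eval m k b z \<notin> Omega m k b) \<or>
     (\<forall>z. 1 < norm z \<and> norm z < 1 + e \<longrightarrow> laurent_eval m k b z \<notin> Omega m k b)"
    using LJ_polynomial_one_sided_annulus_avoids_Omega[OF assms] .
  from side show ?thesis
  proof
    assume inner: "\<forall>z. 1 - e < norm z \<and> norm z < 1 \<longrightarrow> laurent_eval m k b z \<notin> Omega m k b"
    have "norm z \<le> 1 - e" if "w \<in> Omega m k b" "z \<in># Z_in m k b w" for w z
    proof (rule ccontr)
      assume "\<not> norm z \<le> 1 - e"
      moreover from this have "z \<noteq> 0"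
        using e by auto
      ultimately show False
        using inner that Z_roots_nonzero_imp_laurent_eval[OF lp, of z w] by (auto simp: Z_in_def)
    qed
    then have "\<forall>w\<in>Omega m k b. set_mset (Z_in m k b w) \<subseteq> {z. norm z \<le> 1 - e}"
      by blast
    moreover have "0 < 1 - e" "1 - e < 1"
      using e by auto
    ultimately show ?thesis
      unfolding regular_laurent_polynomial_def using lp by blast
  next
    assume outer: "\<forall>z. 1 < norm z \<and> norm z < 1 + e \<longrightarrow> laurent_eval m k b z \<notin> Omega m k b"
    have "norm z \<ge> 1 + e" if "w \<in> Omega m k b" "z \<in># Z_ext m k b w" for w z
    proof (rule ccontr)
      assume "\<not> norm z \<ge> 1 + e"
      moreover have "z \<noteq> 0"
        using that(2) by (auto simp: Z_ext_def)
      ultimately show False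
        using outer that Z_roots_nonzero_imp_laurent_eval[OF lp, of z w] by (auto simp: Z_ext_def)
    qed
    then have "\<forall>w\<in>Omega m k b. set_mset (Z_ext m k b w) \<subseteq> {z. norm z \<ge> 1 + e}"
      by blast
    moreover have "1 + e > 1"
      using e by auto
    ultimately show ?thesis
      unfolding regular_laurent_polynomial_def using lp by blast
  qed
qed

end
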